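(* Let $N\ge1$ be an integer and let $\varphi_n(x)=(-1)^n(-x)_n=x(x-1)\cdots(x-n+1)$ for $n\ge0$, $\varphi_{-1}=0$. Let $W=A_1(x)T^{+}+A_2(x)T^{-}+A_0(x)\mathcal I$ be a second order difference operator on the uniform grid $\{0,1,\dots,N\}$. Then $W$ is tridiagonal with respect to the Pochhammer basis, i.e. for every $n=0,1,\dots,N$ the function $W\varphi_n$ is a linear combination of $\varphi_{n+1},\varphi_n,\varphi_{n-1}$ on the grid, if and only if there exist constants $\kappa,\mu_0,\mu_1,\nu_0,\nu_1,r_0,r_1\in\mathbb C$ such that on the grid $$A_1(x)=(x-N)(\kappa x^2+\mu_1x+\mu_0),\qquad A_2(x)=x(\kappa x^2+\nu_1x+\nu_0),\qquad A_0(x)=-A_1(x)-A_2(x)+r_1x+r_0 .$$ Moreover, in that case, for $n=0,1,\dots,N$, $$W\varphi_n=\sigma_n^{(1)}\varphi_{n+1}+\sigma_n^{(2)}\varphi_n+\sigma_n^{(3)}\varphi_{n-1}$$ with $$\sigma_n^{(1)}=\bigl(\mu_1-\nu_1+\kappa(n-1-N)\bigr)n+r_1,$$ $$\sigma_n^{(2)}=r_0+(\mu_0+r_1-\nu_0-\mu_1N-\nu_1n)n+n(2n-1)\bigl(\mu_1-\kappa(N-n+1)\bigr),$$ $$\sigma_n^{(3)}=-n(N-n+1)\bigl(\mu_0+(n-1)(\mu_1+\kappa(n-1))\bigr).$$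
   Context: Here $(a)_n=a(a+1)\cdots(a+n-1)$ is the Pochhammer symbol, with $(a)_0=1$. Functions on the grid are complex-valued functions on $\{0,1,\dots,N\}$; polynomials are viewed as functions on the grid by restriction (so $\varphi_{N+1}$ is zero on the grid). The shift operators are $T^{\pm}f(x)=f(x\pm1)$ and $\mathcal I$ is the identity. A second order difference operator on the grid is an operator $(Wf)(x)=A_1(x)f(x+1)+A_2(x)f(x-1)+A_0(x)f(x)$, $x\in\{0,\dots,N\}$, where $A_0,A_1,A_2$ are functions on the grid with $A_1(N)=0$ and $A_2(0)=0$ (the terms with $f(N+1)$ and $f(-1)$ are understood to be $0$). *)

theory Defs
  imports Complex_Main
begin

(* Grid functions are represented by functions int => complex of which only the values
   on the grid matter. Working over int makes the shifts x + 1 and x - 1 total. *)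

definition grid :: "nat \<Rightarrow> int set" where
  "grid N = {0..int N}"

(* The integer index n allows n = -1, for which the function is zero by convention. *)

definition phi :: "int \<Rightarrow> int \<Rightarrow> complex" where
  "phi n x = (if n < 0 then 0 else (-1) ^ nat n * pochhammer (- of_int x) (nat n))"

definition diff_op ::
  "(int \<Rightarrow> complex) \<Rightarrow> (int \<Rightarrow> complex) \<Rightarrow> (int \<Rightarrow> complex) \<Rightarrow> (int \<Rightarrow> complex) \<Rightarrow> int \<Rightarrow> complex"
where
  "diff_op A0 A1 A2 f x = A1 x * f (x + 1) + A2 x * f (x - 1) + A0 x * f x"

(* The boundary conditions make the off-grid values f (N + 1) and f (-1) irrelevant,
   so that diff_op is an operator on functions on the grid. *)

definition grid_coeffs :: "nat \<Rightarrow> (int \<Rightarrow> complex) \<Rightarrow> (int \<Rightarrow> complex) \<Rightarrow> bool" where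
  "grid_coeffs N A1 A2 \<longleftrightarrow> A1 (int N) = 0 \<and> A2 0 = 0"

definition tridiagonal :: "nat \<Rightarrow> ((int \<Rightarrow> complex) \<Rightarrow> (int \<Rightarrow> complex)) \<Rightarrow> bool" where
  "tridiagonal N W \<longleftrightarrow>
     (\<forall>n\<le>N. \<exists>a b c :: complex. \<forall>x\<in>grid N.
        W (phi (int n)) x = a * phi (int n + 1) x + b * phi (int n) x + c * phi (int n - 1) x)"

definition coeff_form ::
  "nat \<Rightarrow> (int \<Rightarrow> complex) \<Rightarrow> (int \<Rightarrow> complex) \<Rightarrow> (int \<Rightarrow> complex) \<Rightarrow>
   complex \<Rightarrow> complex \<Rightarrow> complex \<Rightarrow> complex \<Rightarrow> complex \<Rightarrow> complex \<Rightarrow> complex \<Rightarrow> bool"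
where
  "coeff_form N A0 A1 A2 \<kappa> \<mu>0 \<mu>1 \<nu>0 \<nu>1 r0 r1 \<longleftrightarrow>
     (\<forall>x\<in>grid N.
        A1 x = (of_int x - of_nat N) * (\<kappa> * (of_int x)\<^sup>2 + \<mu>1 * of_int x + \<mu>0) \<and>
        A2 x = of_int x * (\<kappa> * (of_int x)\<^sup>2 + \<nu>1 * of_int x + \<nu>0) \<and>
        A0 x = - A1 x - A2 x + r1 * of_int x + r0)"

end

theory Submission
  imports Defs
begin

text \<open>Evaluating \<open>W\<close> on \<open>\<phi>\<^sub>0, \<phi>\<^sub>1, \<phi>\<^sub>2\<close> already determines the shape of the coefficients:
  \<open>n = 0\<close> makes \<open>A\<^sub>0 + A\<^sub>1 + A\<^sub>2\<close> linear, \<open>n = 1\<close> then makes \<open>A\<^sub>1 - A\<^sub>2\<close> quadratic, and \<open>n = 2\<close>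
  makes \<open>x A\<^sub>1 - (x - 1) A\<^sub>2\<close> cubic, so that \<open>A\<^sub>2\<close> is cubic and \<open>A\<^sub>1\<close> is cubic with the same leading
  coefficient; the boundary conditions supply the factors \<open>x\<close> and \<open>x - N\<close>. Conversely,
  \<open>\<phi>\<^sub>n(x + 1)\<close>, \<open>\<phi>\<^sub>n(x)\<close>, \<open>x \<phi>\<^sub>n(x - 1)\<close> and \<open>\<phi>\<^bsub>n+1\<^esub>(x)\<close> are polynomial multiples of \<open>\<phi>\<^bsub>n-1\<^esub>(x)\<close>,
  and the expansion becomes a polynomial identity.\<close>

lemma phi_0 [simp]: "phi 0 x = 1"
  by (simp add: phi_def)

lemma phi_Suc: "phi (int (Suc n)) x = (of_int x - of_nat n) * phi (int n) x"
  by (simp add: phi_def pochhammer_Suc nat_add_distrib algebra_simps)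

text \<open>Splits off the first factor of the product, where \<open>phi_Suc\<close> splits off the
  last; this relates the values at \<open>x + 1\<close> and \<open>x - 1\<close> to those at
  \<open>x\<close>.\<close>

lemma phi_Suc_shift: "phi (int (Suc n)) x = of_int x * phi (int n) (x - 1)"
proof -
  have "(- of_int x + 1 :: complex) = - of_int (x - 1)" by simp
  then show ?thesis
    by (simp add: phi_def pochhammer_rec nat_add_distrib del: of_int_diff)
qed

lemma phi_1: "phi 1 x = of_int x"
  using phi_Suc[of 0 x] by simp

lemma phi_2: "phi 2 x = of_int x * (of_int x - 1)"
  using phi_Suc[of 1 x] by (simp add: phi_1)

lemma phi_3: "phi 3 x = of_int x * (of_int x - 1) * (of_int x - 2)"
  using phi_Suc[of 2 x] by (simp add: phi_2)

lemma diff_op_phi: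
  assumes A1: "A1 x = (of_int x - of_nat N) * (\<kappa> * (of_int x)\<^sup>2 + \<mu>1 * of_int x + \<mu>0)"
    and A2: "A2 x = of_int x * (\<kappa> * (of_int x)\<^sup>2 + \<nu>1 * of_int x + \<nu>0)"
    and A0: "A0 x = - A1 x - A2 x + r1 * of_int x + r0"
  shows "diff_op A0 A1 A2 (phi (int n)) x =
             ((\<mu>1 - \<nu>1 + \<kappa> * (of_nat n - 1 - of_nat N)) * of_nat n + r1) * phi (int n + 1) x
           + (r0 + (\<mu>0 + r1 - \<nu>0 - \<mu>1 * of_nat N - \<nu>1 * of_nat n) * of_nat n
                + of_nat n * (2 * of_nat n - 1) * (\<mu>1 - \<kappa> * (of_nat N - of_nat n + 1)))
               * phi (int n) x
           + (- of_nat n * (of_nat N - of_nat n + 1)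
                * (\<mu>0 + (of_nat n - 1) * (\<mu>1 + \<kappa> * (of_nat n - 1))))
               * phi (int n - 1) x"
proof (cases n)
  \<comment> \<open>Treated apart: \<open>phi (-1)\<close> is zero and cannot serve as the common
    factor.\<close>
  case 0
  then show ?thesis
    by (simp add: diff_op_def A0 phi_1)
next
  case (Suc m)
  define P where "P = phi (int m) x"
  define X :: complex where "X = of_int x"
  define M :: complex where "M = of_nat m"
  define L :: complex where "L = of_nat N"
  have nM: "of_nat n = M + 1"
    by (simp add: Suc M_def)
  have lower: "phi (int n - 1) x = P"
    by (simp add: Suc P_def)
  have same: "phi (int n) x = (X - M) * P"
    unfolding Suc P_def X_def M_def by (rule phi_Suc)
  have upper: "phi (int n + 1) x = (X - M - 1) * (X - M) * P"
    using phi_Suc[of n x] same nM by (simp add: X_def algebra_simps)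
  have right: "phi (int n) (x + 1) = (X + 1) * P"
    using phi_Suc_shift[of m "x + 1"] by (simp add: Suc P_def X_def)
  have left: "X * phi (int n) (x - 1) = (X - M - 1) * (X - M) * P"
    using phi_Suc_shift[of n x] upper by (simp add: X_def algebra_simps)
  \<comment> \<open>In general \<open>phi (int n) (x - 1)\<close> is not a polynomial multiple of
    \<open>P\<close>. Borrowing the factor \<open>X\<close> from \<open>A2 x\<close> turns it into
    \<open>phi (int n + 1) x\<close>, which is one.\<close>
  define Q2 where "Q2 = \<kappa> * X\<^sup>2 + \<nu>1 * X + \<nu>0"
  have "diff_op A0 A1 A2 (phi (int n)) x
      = A1 x * phi (int n) (x + 1) + Q2 * (X * phi (int n) (x - 1)) + A0 x * phi (int n) x"
    by (simp add: diff_op_def A2 Q2_def X_def)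
  also have "\<dots> = (A1 x * (X + 1) + Q2 * ((X - M - 1) * (X - M)) + A0 x * (X - M)) * P"
    unfolding right left same by (simp add: algebra_simps)
  also have "A0 x = - A1 x - X * Q2 + r1 * X + r0"
    by (simp add: A0 A2 Q2_def X_def)
  also have "A1 x = (X - L) * (\<kappa> * X\<^sup>2 + \<mu>1 * X + \<mu>0)"
    by (simp add: A1 X_def L_def)
  finally show ?thesis
    unfolding lower same upper nM L_def[symmetric] Q2_def
    by algebra
qed

lemma tridiagonal_imp_coeff_form:
  assumes "grid_coeffs N A1 A2" and tri: "tridiagonal N (diff_op A0 A1 A2)"
  shows "\<exists>\<kappa> \<mu>0 \<mu>1 \<nu>0 \<nu>1 r0 r1. coeff_form N A0 A1 A2 \<kappa> \<mu>0 \<mu>1 \<nu>0 \<nu>1 r0 r1"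
proof -
  have bdry: "A1 (int N) = 0" "A2 0 = 0"
    using assms(1) by (simp_all add: grid_coeffs_def)
  obtain r1 r0 where n0: "A0 x = - A1 x - A2 x + r1 * of_int x + r0" if "x \<in> grid N" for x
  proof -
    obtain a b c where "\<forall>x\<in>grid N. diff_op A0 A1 A2 (phi (int 0)) x
        = a * phi (int 0 + 1) x + b * phi (int 0) x + c * phi (int 0 - 1) x"
      using tri unfolding tridiagonal_def by blast
    then have "A0 x = - A1 x - A2 x + a * of_int x + b" if "x \<in> grid N" for x
      using that by (auto simp: diff_op_def phi_1 phi_def[of "-1"] algebra_simps
          eq_neg_iff_add_eq_0 dest!: bspec)
    then show ?thesis by (rule that)
  qed
  \<comment> \<open>Tridiagonality speaks only of n \<le> N, so the relation for n = 2 is available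
    only when N \<ge> 2. On smaller grids the coefficients are interpolated.\<close>
  consider "N = 0" | "N = 1" | "N \<ge> 2" by linarith
  then show ?thesis
  proof cases
    case 1
    then have "coeff_form N A0 A1 A2 0 0 0 0 0 r0 r1"
      using bdry n0 by (auto simp: coeff_form_def grid_def)
    then show ?thesis by blast
  next
    case 2
    then have "x = 0 \<or> x = 1" if "x \<in> grid N" for x
      using that by (auto simp: grid_def)
    \<comment> \<open>With \<open>\<kappa> = \<mu>1 = \<nu>1 = 0\<close>, the form requires
      \<open>A1 0 = - \<mu>0\<close> and \<open>A2 1 = \<nu>0\<close>; the other two values vanish
      by the boundary conditions.\<close>
    then have "coeff_form N A0 A1 A2 0 (- A1 0) 0 (A2 1) 0 r0 r1"
      unfolding coeff_form_def using bdry n0 2 by fastforce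
    then show ?thesis by blast
  next
    case 3
    obtain a1 b1 c1 where n1: "\<forall>x\<in>grid N. diff_op A0 A1 A2 (phi (int 1)) x
        = a1 * phi (int 1 + 1) x + b1 * phi (int 1) x + c1 * phi (int 1 - 1) x"
      using tri 3 unfolding tridiagonal_def by (meson le_trans one_le_numeral)
    obtain a2 b2 c2 where n2: "\<forall>x\<in>grid N. diff_op A0 A1 A2 (phi (int 2)) x
        = a2 * phi (int 2 + 1) x + b2 * phi (int 2) x + c2 * phi (int 2 - 1) x"
      using tri 3 unfolding tridiagonal_def by blast
    define \<alpha> where "\<alpha> = a1 - r1"
    define \<beta> where "\<beta> = b1 - a1 - r0"
    \<comment> \<open>Substituting \<open>A1 = A2 + \<alpha> x^2 + \<beta> x + c1\<close> into the
      relation for n = 2 leaves \<open>2 * A2\<close> equal to a cubic divisible by x. These are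
      half its coefficients.\<close>
    define \<kappa> where "\<kappa> = (a2 - r1 - 2 * \<alpha>) / 2"
    define \<nu>1 where "\<nu>1 = (- 3 * a2 + b2 + r1 - r0 - 2 * \<beta>) / 2"
    define \<nu>0 where "\<nu>0 = (2 * a2 - b2 + c2 + r0 - 2 * c1) / 2"
    have diff: "A1 x - A2 x = \<alpha> * (of_int x)\<^sup>2 + \<beta> * of_int x + c1" if "x \<in> grid N" for x
    proof -
      have "A1 x * (of_int x + 1) + A2 x * (of_int x - 1) + A0 x * of_int x
          = a1 * (of_int x * (of_int x - 1)) + b1 * of_int x + c1"
        using n1 that by (auto simp: diff_op_def phi_1 phi_2 dest!: bspec)
      then show ?thesis
        unfolding n0[OF that] \<alpha>_def \<beta>_def by algebra
    qed
    have A2: "A2 x = of_int x * (\<kappa> * (of_int x)\<^sup>2 + \<nu>1 * of_int x + \<nu>0)" if "x \<in> grid N" for x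
    proof -
      have "A1 x * ((of_int x + 1) * of_int x) + A2 x * ((of_int x - 1) * (of_int x - 2))
            + A0 x * (of_int x * (of_int x - 1))
          = a2 * (of_int x * (of_int x - 1) * (of_int x - 2))
            + b2 * (of_int x * (of_int x - 1)) + c2 * of_int x"
        using n2 that by (auto simp: diff_op_def phi_1 phi_2 phi_3 dest!: bspec)
      \<comment> \<open>Eliminating \<open>A0\<close> leaves \<open>A1\<close> with (x+1)x - x(x-1)
        = 2x and \<open>A2\<close> with (x-1)(x-2) - x(x-1) = -2(x-1).\<close>
      then have "2 * of_int x * A1 x - 2 * (of_int x - 1) * A2 x
            + (r1 * of_int x + r0) * of_int x * (of_int x - 1)
          = a2 * (of_int x * (of_int x - 1) * (of_int x - 2))
            + b2 * (of_int x * (of_int x - 1)) + c2 * of_int x"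
        unfolding n0[OF that] by algebra
      with diff[OF that] have "2 * A2 x = of_int x * (2 * \<kappa> * (of_int x)\<^sup>2 + 2 * \<nu>1 * of_int x + 2 * \<nu>0)"
        unfolding \<kappa>_def \<nu>1_def \<nu>0_def by simp algebra
      then have "2 * A2 x = 2 * (of_int x * (\<kappa> * (of_int x)\<^sup>2 + \<nu>1 * of_int x + \<nu>0))"
        by (simp add: algebra_simps)
      then show ?thesis by simp
    qed
    \<comment> \<open>Horner division of the cubic \<open>A1\<close> by \<open>x - N\<close>; the remainder is \<open>A1 N = 0\<close>.\<close>
    define \<mu>1 where "\<mu>1 = \<nu>1 + \<alpha> + of_nat N * \<kappa>"
    define \<mu>0 where "\<mu>0 = \<nu>0 + \<beta> + of_nat N * \<mu>1"
    have N: "int N \<in> grid N" by (simp add: grid_def)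
    have rem: "c1 + of_nat N * \<mu>0 = 0"
      using diff[OF N] A2[OF N] bdry(1) unfolding \<mu>0_def \<mu>1_def of_int_of_nat_eq by algebra
    have "A1 x = (of_int x - of_nat N) * (\<kappa> * (of_int x)\<^sup>2 + \<mu>1 * of_int x + \<mu>0)"
      if "x \<in> grid N" for x
      using diff[OF that] A2[OF that] rem unfolding \<mu>0_def \<mu>1_def by algebra
    then have "coeff_form N A0 A1 A2 \<kappa> \<mu>0 \<mu>1 \<nu>0 \<nu>1 r0 r1"
      using A2 n0 by (simp add: coeff_form_def)
    then show ?thesis by blast
  qed
qed

theorem mainTheorem2:
  fixes N :: nat and A0 A1 A2 :: "int \<Rightarrow> complex"
  assumes "N \<ge> 1" and "grid_coeffs N A1 A2"
  shows
    "(tridiagonal N (diff_op A0 A1 A2) \<longleftrightarrow>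
        (\<exists>\<kappa> \<mu>0 \<mu>1 \<nu>0 \<nu>1 r0 r1. coeff_form N A0 A1 A2 \<kappa> \<mu>0 \<mu>1 \<nu>0 \<nu>1 r0 r1)) \<and>
     (\<forall>\<kappa> \<mu>0 \<mu>1 \<nu>0 \<nu>1 r0 r1. coeff_form N A0 A1 A2 \<kappa> \<mu>0 \<mu>1 \<nu>0 \<nu>1 r0 r1 \<longrightarrow>
        (\<forall>n\<le>N. \<forall>x\<in>grid N.
           diff_op A0 A1 A2 (phi (int n)) x =
             ((\<mu>1 - \<nu>1 + \<kappa> * (of_nat n - 1 - of_nat N)) * of_nat n + r1) * phi (int n + 1) x
           + (r0 + (\<mu>0 + r1 - \<nu>0 - \<mu>1 * of_nat N - \<nu>1 * of_nat n) * of_nat n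
                + of_nat n * (2 * of_nat n - 1) * (\<mu>1 - \<kappa> * (of_nat N - of_nat n + 1)))
               * phi (int n) x
           + (- of_nat n * (of_nat N - of_nat n + 1)
                * (\<mu>0 + (of_nat n - 1) * (\<mu>1 + \<kappa> * (of_nat n - 1))))
               * phi (int n - 1) x))"
proof (intro conjI iffI allI impI ballI)
  assume "tridiagonal N (diff_op A0 A1 A2)"
  with assms(2) show "\<exists>\<kappa> \<mu>0 \<mu>1 \<nu>0 \<nu>1 r0 r1. coeff_form N A0 A1 A2 \<kappa> \<mu>0 \<mu>1 \<nu>0 \<nu>1 r0 r1"
    by (rule tridiagonal_imp_coeff_form)
next
  assume "\<exists>\<kappa> \<mu>0 \<mu>1 \<nu>0 \<nu>1 r0 r1. coeff_form N A0 A1 A2 \<kappa> \<mu>0 \<mu>1 \<nu>0 \<nu>1 r0 r1"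
  then obtain \<kappa> \<mu>0 \<mu>1 \<nu>0 \<nu>1 r0 r1 where "coeff_form N A0 A1 A2 \<kappa> \<mu>0 \<mu>1 \<nu>0 \<nu>1 r0 r1"
    by blast
  \<comment> \<open>The coefficients in \<open>diff_op_phi\<close> depend on n but not on x, so they
    are the required witnesses.\<close>
  then show "tridiagonal N (diff_op A0 A1 A2)"
    unfolding tridiagonal_def coeff_form_def by (blast intro: diff_op_phi)
qed (rule diff_op_phi; simp add: coeff_form_def)

end
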